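(* For any real number $\alpha>0$ we have $$\sum_{i,j\geq 0} \frac{q^{\frac{\alpha}{2}i^2+(1-\alpha)ij+\frac{\alpha}{2}j^2+(1-\frac{\alpha}{2})i+\frac{\alpha}{2}j}}{(q;q)_i(q;q)_j}=\frac{(q^{2\alpha};q^{2\alpha})_\infty^2}{(q;q)_\infty (q^\alpha;q^\alpha)_\infty}.$$
   Context: Here $q$ is a complex number with $0<|q|<1$; real powers of $q$ are defined by $q^s=\exp(s\log q)$ for one fixed choice of $\log q$ (e.g. $0<q<1$ with the real logarithm). For $|p|<1$, $(a;p)_\infty=\prod_{n\ge 0}(1-ap^n)$, and $(a;p)_n=(a;p)_\infty/(ap^n;p)_\infty=\prod_{k=0}^{n-1}(1-ap^k)$ for integers $n\ge 0$. The sum runs over all pairs of nonnegative integers $(i,j)$. *)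

theory Defs
  imports "HOL-Analysis.Analysis"
begin

text \<open>
  The real power $q^s = \exp(s \log q)$, where the argument \<open>L\<close> is the fixed choice of $\log q$,
  i.e. any complex number with \<open>exp L = q\<close> (not necessarily the principal one).
\<close>
definition qpow :: "complex \<Rightarrow> real \<Rightarrow> complex" where
  "qpow L s = exp (of_real s * L)"

definition qpoch :: "complex \<Rightarrow> complex \<Rightarrow> nat \<Rightarrow> complex" where
  "qpoch a p n = (\<Prod>k<n. 1 - a * p ^ k)"

definition qpoch_inf :: "complex \<Rightarrow> complex \<Rightarrow> complex" where
  "qpoch_inf a p = (\<Prod>n. 1 - a * p ^ n)"

text \<open>For \<open>norm p < 1\<close> the product converges, so \<^const>\<open>prodinf\<close> denotes its actual value.\<close>
lemma qpoch_inf_has_prod: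
  assumes "norm p < 1"
  shows "(\<lambda>n. 1 - a * p ^ n) has_prod qpoch_inf a p"
proof -
  have "summable (\<lambda>n. norm a * norm p ^ n)"
    using assms by (intro summable_mult summable_geometric) auto
  then have "summable (\<lambda>n. norm ((1 - a * p ^ n) - 1))"
    by (simp add: norm_mult norm_power)
  then have "abs_convergent_prod (\<lambda>n. 1 - a * p ^ n)"
    by (simp add: abs_convergent_prod_conv_summable)
  then show ?thesis
    unfolding qpoch_inf_def
    by (intro convergent_prod_has_prod abs_convergent_prod_imp_convergent_prod)
qed

end

(* With n = i - j the exponent is alpha n (n - 1) / 2 + i (j + 1), and n (n - 1) / 2 is invariant
   under n -> 1 - n. The terms of the diagonals n = -m and n = m + 1 combine pairwise to the terms
   of Durfee's series sum_b q^(b (b + m + 1)) / ((q; q)_b (q; q)_(b + m + 1)) = 1 / (q; q)_inf, so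
   the double sum is 1 / (q; q)_inf times sum_m Q^(m (m + 1) / 2) with Q = q^alpha. For alpha = 1 the
   double sum is also the square of Euler's series for (-q; q)_inf, which proves Gauss's
   identity for the triangular series; applied in base Q, it evaluates the remaining sum. *)

theory Submission
  imports Defs
begin

text \<open>Fubini for a product family. The absolute version is stated as well because it later
  supplies a summable majorant for a double series.\<close>

lemma has_sum_times:
  fixes f :: "'a \<Rightarrow> 'c :: {real_normed_field, banach}" and g :: "'b \<Rightarrow> 'c"
  assumes f: "(\<lambda>x. norm (f x)) summable_on A" "(f has_sum S) A"
    and g: "(\<lambda>x. norm (g x)) summable_on B" "(g has_sum T) B"
  shows "(\<lambda>z. norm (case z of (x, y) \<Rightarrow> f x * g y)) summable_on A \<times> B"
    and "((\<lambda>(x, y). f x * g y) has_sum S * T) (A \<times> B)"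
proof -
  show abs: "(\<lambda>z. norm (case z of (x, y) \<Rightarrow> f x * g y)) summable_on A \<times> B"
    using f(1) g(1)
    by (subst Infinite_Sum.abs_summable_on_Sigma_iff)
      (auto simp: norm_mult infsum_cmult_right' abs_mult
        intro!: summable_on_cmult_right summable_on_cmult_left)
  show "((\<lambda>(x, y). f x * g y) has_sum S * T) (A \<times> B)"
  proof (rule has_sum_SigmaI)
    show "((\<lambda>y. case (x, y) of (x, y) \<Rightarrow> f x * g y) has_sum f x * T) B" for x
      using has_sum_cmult_right[OF g(2), of "f x"] by simp
    show "((\<lambda>x. f x * T) has_sum S * T) A"
      by (rule has_sum_cmult_left[OF f(2)])
  qed (rule Infinite_Sum.abs_summable_summable[OF abs])
qed

section \<open>Nonvanishing and bounds for q-Pochhammer symbols\<close>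

lemma qpoch_0 [simp]: "qpoch a p 0 = 1"
  by (simp add: qpoch_def)

lemma qpoch_Suc: "qpoch a p (Suc n) = qpoch a p n * (1 - a * p ^ n)"
  by (simp add: qpoch_def)

lemma qpoch_tendsto:
  assumes "norm p < 1"
  shows "qpoch a p \<longlonglongrightarrow> qpoch_inf a p"
  using has_prod_imp_tendsto'[OF qpoch_inf_has_prod[OF assms]] by (simp add: qpoch_def[abs_def])

lemma qpoch_q_factor_nonzero:
  fixes q :: complex
  assumes "norm q < 1"
  shows "1 - q * q ^ n \<noteq> 0"
proof
  assume "1 - q * q ^ n = 0"
  then have "norm (q ^ Suc n) = 1"
    by simp
  moreover have "norm (q ^ Suc n) < 1"
    using assms by (simp add: norm_power power_less_one_iff del: power_Suc)
  ultimately show False by simp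
qed

lemma qpoch_q_nonzero:
  assumes "norm q < 1"
  shows "qpoch q q n \<noteq> 0"
  using qpoch_q_factor_nonzero[OF assms] by (simp add: qpoch_def)

text \<open>A convergent infinite product vanishes only if one of its factors does.\<close>

lemma qpoch_inf_q_nonzero:
  assumes "norm q < 1"
  shows "qpoch_inf q q \<noteq> 0"
  using qpoch_inf_has_prod[OF assms, of q] qpoch_q_factor_nonzero[OF assms]
  by (auto simp: has_prod_eq_0_iff)

lemma qpoch_q_inverse_bounded:
  assumes "norm q < 1"
  obtains C where "C > 0" "\<And>n. norm (1 / qpoch q q n) \<le> C"
proof -
  have "(\<lambda>n. 1 / qpoch q q n) \<longlonglongrightarrow> 1 / qpoch_inf q q"
    using qpoch_tendsto[OF assms] qpoch_inf_q_nonzero[OF assms] by (intro tendsto_intros)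
  then have "Bseq (\<lambda>n. 1 / qpoch q q n)"
    by (intro convergent_imp_Bseq convergentI)
  then show thesis
    using that by (auto elim: BseqE)
qed

text \<open>The source of the geometric majorants below: \<open>C\<close> is uniform in
  \<open>i\<close> and \<open>j\<close>, and the free \<open>k\<close> lets a quadratic exponent be
  replaced by whichever linear lower bound is wanted.\<close>

lemma qpoch_q_double_bounded:
  assumes "norm q < 1"
  obtains C where "C > 0"
    "\<And>e k i j. k \<le> e \<Longrightarrow> norm (q ^ e / (qpoch q q i * qpoch q q j)) \<le> C * norm q ^ k"
proof -
  obtain C where C: "C > 0" "\<And>n. norm (1 / qpoch q q n) \<le> C"
    using qpoch_q_inverse_bounded[OF assms] by blast
  have "norm (q ^ e / (qpoch q q i * qpoch q q j)) \<le> (C * C) * norm q ^ k" if "k \<le> e" for e k i j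
  proof -
    have "norm (q ^ e / (qpoch q q i * qpoch q q j))
        = norm (1 / qpoch q q i) * norm (1 / qpoch q q j) * norm q ^ e"
      by (simp add: norm_divide norm_mult norm_power)
    also have "\<dots> \<le> (C * C) * norm q ^ k"
      using C assms that by (intro mult_mono power_decreasing) (auto intro: less_imp_le)
    finally show ?thesis .
  qed
  then show thesis
    using that[of "C * C"] C(1) by simp
qed

subsection \<open>Sums along a diagonal\<close>

lemma summable_norm_durfee:
  assumes "norm q < 1"
  shows "summable (\<lambda>b. norm (q ^ (b * (b + m)) / (qpoch q q b * qpoch q q (b + m))))"
proof -
  obtain C where C: "C > 0"
    "\<And>e k i j. k \<le> e \<Longrightarrow> norm (q ^ e / (qpoch q q i * qpoch q q j)) \<le> C * norm q ^ k"
    using qpoch_q_double_bounded[OF assms] by blast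
  have "summable (\<lambda>b. C * norm q ^ b)"
    using assms by (intro summable_mult summable_geometric) auto
  moreover have "norm (norm (q ^ (b * (b + m)) / (qpoch q q b * qpoch q q (b + m)))) \<le> C * norm q ^ b" for b
    using C(2)[of b "b * (b + m)" b "b + m"] by (cases b) auto
  ultimately show ?thesis
    by (rule summable_comparison_test'[where N = 0])
qed

text \<open>The summands belong to \<open>(i, j) = (b, b + m)\<close> and
  \<open>(b + m + 1, b)\<close>. Their exponents \<open>i * (j + 1)\<close> differ by
  \<open>b + m + 1\<close>, so over the common denominator the numerators combine through
  \<open>(1 - x) + x = 1\<close> with \<open>x = q ^ (b + m + 1)\<close>.\<close>

lemma durfee_split:
  assumes "norm q < 1"
  shows "q ^ (b * (b + m + 1)) / (qpoch q q b * qpoch q q (b + m))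
       + q ^ ((b + m + 1) * (b + 1)) / (qpoch q q (b + m + 1) * qpoch q q b)
       = q ^ (b * (b + m + 1)) / (qpoch q q b * qpoch q q (b + m + 1))"
proof -
  note nz = qpoch_q_nonzero[OF assms, of b] qpoch_q_nonzero[OF assms, of "b + m"]
    qpoch_q_factor_nonzero[OF assms, of "b + m"]
  have "q ^ ((b + m + 1) * (b + 1)) = q ^ (b * (b + m + 1)) * (q * q ^ (b + m))"
    by (simp flip: power_add power_Suc add: algebra_simps)
  then show ?thesis
    using nz by (simp add: qpoch_Suc divide_simps) (simp add: algebra_simps)
qed

text \<open>Writing \<open>1 = q ^ b + (1 - q ^ b)\<close> in the \<open>b\<close>-th term for \<open>m\<close> gives the same two series
  (the second one after a shift of \<open>b\<close>) as the splitting above gives for \<open>m + 1\<close>. So the sum does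
  not depend on \<open>m\<close>, and for \<open>m \<longlonglongrightarrow> \<infinity>\<close> only the term \<open>b = 0\<close> survives.\<close>

lemma durfee_sums:
  assumes "norm q < 1"
  shows "(\<lambda>b. q ^ (b * (b + m)) / (qpoch q q b * qpoch q q (b + m))) sums (1 / qpoch_inf q q)"
proof -
  define d where "d m b = q ^ (b * (b + m)) / (qpoch q q b * qpoch q q (b + m))" for m b
  define D where "D m = suminf (d m)" for m
  obtain C where C: "C > 0"
    "\<And>e k i j. k \<le> e \<Longrightarrow> norm (q ^ e / (qpoch q q i * qpoch q q j)) \<le> C * norm q ^ k"
    using qpoch_q_double_bounded[OF assms] by blast
  have geo: "summable (\<lambda>b. C * norm q ^ b)"
    using assms by (intro summable_mult summable_geometric) auto
  have sm: "summable (d m)" for m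
    using summable_norm_cancel[OF summable_norm_durfee[OF assms, of m]] by (simp add: d_def[abs_def])
  have step: "D m = D (Suc m)" for m
  proof -
    define u where "u b = q ^ (b * (b + m + 1)) / (qpoch q q b * qpoch q q (b + m))" for b
    define v where "v b = q ^ ((b + m + 1) * (b + 1)) / (qpoch q q (b + m + 1) * qpoch q q b)" for b
    have su: "summable u"
      by (rule summable_comparison_test'[OF geo, where N = 0]) (unfold u_def, rule C(2), simp)
    have sv: "summable v"
      by (rule summable_comparison_test'[OF geo, where N = 0]) (unfold v_def, rule C(2), simp)
    have d0: "d m 0 - u 0 = 0"
      by (simp add: d_def u_def)
    \<comment> \<open>The subtraction leaves the factor \<open>1 - q ^ (b + 1)\<close>, which
      cancels the last factor of \<open>qpoch q q (Suc b)\<close>; this produces the shift of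
      \<open>b\<close>.\<close>
    have d1: "d m (Suc b) - u (Suc b) = v b" for b
    proof -
      have "d m (Suc b) - u (Suc b) = q ^ (Suc b * (Suc b + m)) * (1 - q * q ^ b)
          / (qpoch q q (Suc b) * qpoch q q (Suc b + m))"
        unfolding d_def u_def diff_divide_distrib[symmetric]
        by (simp add: power_add algebra_simps)
      also have "\<dots> = v b"
        unfolding v_def using qpoch_q_factor_nonzero[OF assms, of b]
        by (simp add: qpoch_Suc mult_ac)
      finally show ?thesis .
    qed
    have "D m - suminf u = (\<Sum>b. d m b - u b)"
      unfolding D_def by (intro suminf_diff sm su)
    also have "\<dots> = suminf v"
      using suminf_split_head[OF summable_diff[OF sm su], of m] d0 d1 by simp
    finally have "D m = suminf u + suminf v"
      by (simp add: algebra_simps)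
    also have "\<dots> = (\<Sum>b. u b + v b)"
      by (rule suminf_add[OF su sv])
    also have "\<dots> = D (Suc m)"
      unfolding D_def u_def v_def d_def by (subst durfee_split[OF assms]) simp
    finally show ?thesis .
  qed
  have const: "D n = D 0" for n
    by (induction n) (simp_all flip: step)
  have lim0: "(\<lambda>n. d n b) \<longlonglongrightarrow> (if b = 0 then 1 / qpoch_inf q q else 0)" for b
  proof (cases "b = 0")
    case True
    then show ?thesis
      using qpoch_tendsto[OF assms, of q] qpoch_inf_q_nonzero[OF assms]
      by (auto simp: d_def intro!: tendsto_intros)
  next
    case False
    \<comment> \<open>For \<open>b \<ge> 1\<close> the exponent \<open>b * (b + n)\<close> is at
      least \<open>n\<close>, which gives decay in \<open>n\<close>.\<close>
    have "norm (d n b) \<le> C * norm q ^ n" for n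
      unfolding d_def using False by (intro C(2)) (cases b, auto)
    then have "\<forall>\<^sub>F n in sequentially. norm (d n b) \<le> C * norm q ^ n"
      by simp
    moreover have "(\<lambda>n. C * norm q ^ n) \<longlonglongrightarrow> 0"
      using assms by (intro tendsto_mult_right_zero LIMSEQ_power_zero) auto
    ultimately have "(\<lambda>n. d n b) \<longlonglongrightarrow> 0"
      by (rule Lim_null_comparison)
    then show ?thesis
      using False by simp
  qed
  \<comment> \<open>The exponent is also at least \<open>b\<close>, which gives a summable majorant
    uniform in \<open>n\<close>, as Tannery's theorem requires.\<close>
  have "norm (d n b) \<le> C * norm q ^ b" for n b
    unfolding d_def by (intro C(2)) (cases b, auto)
  then have "D \<longlonglongrightarrow> (\<Sum>b. if b = 0 then 1 / qpoch_inf q q else 0)"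
    unfolding D_def
    using tannerys_theorem[where a = "\<lambda>b n. d n b" and M = "\<lambda>b. C * norm q ^ b", OF lim0 _ geo]
    by (auto simp: always_eventually)
  moreover have "(\<Sum>b. if b = 0 then 1 / qpoch_inf q q else 0) = 1 / qpoch_inf q q"
    using sums_unique[OF sums_single[of 0 "\<lambda>_. 1 / qpoch_inf q q"]] by simp
  moreover have "D = (\<lambda>_. D m)"
    using const by metis
  ultimately have "D m = 1 / qpoch_inf q q"
    by (metis LIMSEQ_const_iff)
  then show ?thesis
    using summable_sums[OF sm, of m] by (simp add: D_def d_def[abs_def])
qed

text \<open>The weight depends on \<open>i - j\<close> only, and identifies \<open>i - j = -m\<close> with \<open>i - j = m + 1\<close>.\<close>

lemma weighted_double_sum:
  fixes w :: "nat \<Rightarrow> complex"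
  assumes q: "norm q < 1" and w: "(\<lambda>x. norm (w x)) summable_on UNIV" "(w has_sum S) UNIV"
  shows "((\<lambda>(i, j). w (if i \<le> j then j - i else i - j - 1) * q ^ (i * (j + 1))
            / (qpoch q q i * qpoch q q j)) has_sum (S / qpoch_inf q q)) UNIV"
proof -
  define F where "F = (\<lambda>(i, j). w (if i \<le> j then j - i else i - j - 1) * q ^ (i * (j + 1))
            / (qpoch q q i * qpoch q q j))"
  define f where "f = (\<lambda>(m, b). w m * (q ^ (b * (b + m + 1)) / (qpoch q q b * qpoch q q (b + m))))"
  define g where "g = (\<lambda>(m, b). w m * (q ^ ((b + m + 1) * (b + 1))
            / (qpoch q q (b + m + 1) * qpoch q q b)))"
  obtain C where C: "C > 0"
    "\<And>e k i j. k \<le> e \<Longrightarrow> norm (q ^ e / (qpoch q q i * qpoch q q j)) \<le> C * norm q ^ k"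
    using qpoch_q_double_bounded[OF q] by blast
  have "summable (\<lambda>b. C * norm q ^ b)"
    using q by (intro summable_mult summable_geometric) auto
  then have geo: "(\<lambda>b. C * norm q ^ b) summable_on UNIV"
    using C(1) by (subst summable_on_UNIV_nonneg_real_iff) auto
  \<comment> \<open>One majorant serves both \<open>f\<close> and \<open>g\<close>, since their
    exponents of \<open>q\<close> are at least \<open>b\<close>.\<close>
  have "(\<lambda>z. norm (case z of (m, b) \<Rightarrow> norm (w m) * (C * norm q ^ b))) summable_on UNIV \<times> UNIV"
    using w(1) geo C(1)
    by (intro has_sum_times(1)[OF _ has_sum_infsum _ has_sum_infsum]) auto
  then have dom: "(\<lambda>(m, b). norm (w m) * (C * norm q ^ b)) summable_on UNIV"
    by (simp add: Infinite_Sum.abs_summable_summable)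
  have "(\<lambda>x. norm (f x)) summable_on UNIV"
    using dom by (rule Infinite_Sum.abs_summable_on_comparison_test')
      (simp only: f_def split_beta norm_mult, intro mult_left_mono C(2), simp_all)
  then obtain s where s: "(f has_sum s) UNIV"
    using Infinite_Sum.abs_summable_summable summable_on_def by blast
  have "(\<lambda>x. norm (g x)) summable_on UNIV"
    using dom by (rule Infinite_Sum.abs_summable_on_comparison_test')
      (simp only: g_def split_beta norm_mult, intro mult_left_mono C(2), simp_all)
  then obtain t where t: "(g has_sum t) UNIV"
    using Infinite_Sum.abs_summable_summable summable_on_def by blast
  have "(F has_sum s) {(i, j). i \<le> j}"
  proof (subst has_sum_reindex_bij_witness[where
        i = "\<lambda>(m, b). (b, b + m)" and j = "\<lambda>(i, j). (j - i, i)" and T = UNIV and h = f])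
    show "(f has_sum s) UNIV" by (rule s)
  qed (auto simp: F_def f_def)
  \<comment> \<open>The shift by one in \<open>i - j - 1\<close> gives this half the same weights
    \<open>w m\<close>, \<open>m \<ge> 0\<close>, as the half \<open>i \<le> j\<close>.\<close>
  moreover have "(F has_sum t) {(i, j). j < i}"
  proof (subst has_sum_reindex_bij_witness[where
        i = "\<lambda>(m, b). (b + m + 1, b)" and j = "\<lambda>(i, j). (i - j - 1, j)" and T = UNIV and h = g])
    show "(g has_sum t) UNIV" by (rule t)
    fix a :: "nat \<times> nat"
    assume "a \<in> {(i, j). j < i}"
    then obtain k j where a: "a = (j + k + 1, j)"
      by (auto dest: less_imp_Suc_add)
    then show "g (case a of (i, j) \<Rightarrow> (i - j - 1, j)) = F a"
      by (simp add: F_def g_def)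
  qed auto
  ultimately have "(F has_sum (s + t)) ({(i, j). i \<le> j} \<union> {(i, j). j < i})"
    by (rule has_sum_Un_disjoint) auto
  also have "{(i, j). i \<le> j} \<union> {(i, j). j < i} = (UNIV :: (nat \<times> nat) set)"
    by auto
  finally have F: "(F has_sum (s + t)) UNIV" .
  \<comment> \<open>Summing over \<open>b\<close> first: for fixed \<open>m\<close> the paired terms
    form Durfee's series with parameter \<open>Suc m\<close>, whose value is independent of
    \<open>m\<close>.\<close>
  have "((\<lambda>m. w m * (1 / qpoch_inf q q)) has_sum (s + t)) UNIV"
  proof (rule has_sum_SigmaD)
    show "((\<lambda>x. f x + g x) has_sum (s + t)) (UNIV \<times> UNIV)"
      using has_sum_add[OF s t] by simp
    fix m :: nat
    have "f (m, b) + g (m, b) = w m * (q ^ (b * (b + Suc m)) / (qpoch q q b * qpoch q q (b + Suc m)))" for b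
      unfolding f_def g_def prod.case distrib_left[symmetric] durfee_split[OF q] by simp
    moreover have "((\<lambda>b. w m * (q ^ (b * (b + Suc m)) / (qpoch q q b * qpoch q q (b + Suc m))))
        has_sum w m * (1 / qpoch_inf q q)) UNIV"
      by (intro has_sum_cmult_right norm_summable_imp_has_sum summable_norm_durfee durfee_sums q)
    ultimately show "((\<lambda>b. f (m, b) + g (m, b)) has_sum w m * (1 / qpoch_inf q q)) UNIV"
      by (simp only:)
  qed
  then have "s + t = S * (1 / qpoch_inf q q)"
    by (rule has_sum_unique) (rule has_sum_cmult_left[OF w(2)])
  then have "s + t = S / qpoch_inf q q"
    by simp
  with F show ?thesis
    by (simp add: F_def)
qed

subsection \<open>Identities of Euler and Gauss\<close>

lemma summable_norm_euler:
  assumes "norm q < 1" "norm z < 1"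
  shows "summable (\<lambda>i. norm (z ^ i * q ^ (i choose 2) / qpoch q q i))"
proof -
  obtain C where C: "C > 0" "\<And>n. norm (1 / qpoch q q n) \<le> C"
    using qpoch_q_inverse_bounded[OF assms(1)] by blast
  have "norm (z ^ i * q ^ (i choose 2) / qpoch q q i) \<le> C * norm z ^ i" for i
  proof -
    have "norm (z ^ i * q ^ (i choose 2) / qpoch q q i)
        = norm (1 / qpoch q q i) * (norm z ^ i * norm q ^ (i choose 2))"
      by (simp add: norm_divide norm_mult norm_power)
    also have "\<dots> \<le> C * (norm z ^ i * 1)"
      using C assms by (intro mult_mono power_le_one) auto
    finally show ?thesis by simp
  qed
  then have "norm (norm (z ^ i * q ^ (i choose 2) / qpoch q q i)) \<le> C * norm z ^ i" for i
    by simp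
  moreover have "summable (\<lambda>i. C * norm z ^ i)"
    using assms by (intro summable_mult summable_geometric) auto
  ultimately show ?thesis
    by (rule summable_comparison_test'[where N = 0, rotated])
qed

text \<open>The series \<open>E\<close> satisfies \<open>E y = (1 + y) * E (y * q)\<close>.
  Iteration splits off the partial products, and \<open>E (z * q ^ n)\<close> tends to 1, the value
  of the term \<open>i = 0\<close>.\<close>

lemma euler_sums:
  assumes q: "norm q < 1" and z: "norm z < 1"
  shows "(\<lambda>i. z ^ i * q ^ (i choose 2) / qpoch q q i) sums qpoch_inf (- z) q"
proof -
  define e where "e y i = y ^ i * q ^ (i choose 2) / qpoch q q i" for y i
  define E where "E y = suminf (e y)" for y
  have sm: "summable (e y)" if "norm y < 1" for y
    using summable_norm_cancel[OF summable_norm_euler[OF q that]] by (simp add: e_def[abs_def])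
  have step: "E y = (1 + y) * E (y * q)" if y: "norm y < 1" for y
  proof -
    have yq: "norm (y * q) < 1"
      using mult_strict_mono'[OF y q] by (simp add: norm_mult)
    have e0: "e y 0 - e (y * q) 0 = 0"
      by (simp add: e_def)
    \<comment> \<open>The difference contributes \<open>1 - q ^ (i + 1)\<close>, which cancels in
      the denominator; the step from \<open>i choose 2\<close> to \<open>Suc i choose 2\<close>
      supplies the \<open>q ^ i\<close> that turns \<open>y ^ i\<close> into
      \<open>(y * q) ^ i\<close>.\<close>
    have e1: "e y (Suc i) - e (y * q) (Suc i) = y * e (y * q) i" for i
    proof -
      have "e y (Suc i) - e (y * q) (Suc i)
          = y ^ Suc i * q ^ (Suc i choose 2) * (1 - q * q ^ i) / qpoch q q (Suc i)"
        unfolding e_def diff_divide_distrib[symmetric]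
        by (simp add: power_mult_distrib algebra_simps)
      also have "\<dots> = y * e (y * q) i"
        using qpoch_q_factor_nonzero[OF q, of i]
        by (simp add: qpoch_Suc e_def numeral_2_eq_2 power_add power_mult_distrib mult_ac)
      finally show ?thesis .
    qed
    have "E y - E (y * q) = (\<Sum>i. e y i - e (y * q) i)"
      unfolding E_def by (intro suminf_diff sm y yq)
    also have "\<dots> = (\<Sum>i. y * e (y * q) i)"
      using suminf_split_head[OF summable_diff[OF sm[OF y] sm[OF yq]]] e0 e1 by simp
    also have "\<dots> = y * E (y * q)"
      unfolding E_def by (rule suminf_mult[OF sm[OF yq]])
    finally show ?thesis
      by (simp add: algebra_simps)
  qed
  have small: "norm (z * q ^ n) \<le> norm z" for n
    using q by (simp add: norm_mult norm_power mult_left_le power_le_one)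
  have iter: "E z = qpoch (- z) q n * E (z * q ^ n)" for n
  proof (induction n)
    case (Suc n)
    then show ?case
      using step[of "z * q ^ n"] small[of n] z by (simp add: qpoch_Suc mult_ac)
  qed simp
  have lim: "(\<lambda>n. e (z * q ^ n) i) \<longlonglongrightarrow> (if i = 0 then 1 else 0)" for i
  proof (cases i)
    case (Suc k)
    have null: "(\<lambda>n. z * q ^ n) \<longlonglongrightarrow> z * 0"
      using q by (intro tendsto_intros LIMSEQ_power_zero)
    have "(\<lambda>n. (z * q ^ n) ^ i * q ^ (i choose 2) / qpoch q q i)
        \<longlonglongrightarrow> (z * 0) ^ i * q ^ (i choose 2) / qpoch q q i"
      using qpoch_q_nonzero[OF q] by (intro tendsto_divide tendsto_mult tendsto_power[OF null] tendsto_const)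
    then show ?thesis
      using Suc by (simp add: e_def)
  qed (simp add: e_def numeral_2_eq_2)
  \<comment> \<open>Since \<open>norm (z * q ^ n) \<le> norm z\<close>, the series at
    \<open>z\<close> itself is the majorant for Tannery's theorem.\<close>
  have "norm (e (z * q ^ n) i) \<le> norm (e z i)" for n i
    using power_mono[OF small[of n], of i]
    by (auto simp: e_def norm_divide norm_mult norm_power
        intro!: divide_right_mono mult_right_mono)
  then have "(\<lambda>n. E (z * q ^ n)) \<longlonglongrightarrow> (\<Sum>i. if i = 0 then 1 else 0)"
    unfolding E_def
    using tannerys_theorem[where a = "\<lambda>i n. e (z * q ^ n) i" and M = "\<lambda>i. norm (e z i)", OF lim]
      summable_norm_euler[OF q z]
    by (auto simp: always_eventually e_def[abs_def])
  moreover have "(\<Sum>i. if i = 0 then 1 else 0) = (1 :: complex)"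
    using sums_unique[OF sums_single[of 0 "\<lambda>_. 1 :: complex"]] by simp
  ultimately have "(\<lambda>n. qpoch (- z) q n * E (z * q ^ n)) \<longlonglongrightarrow> qpoch_inf (- z) q * 1"
    by (intro tendsto_mult qpoch_tendsto[OF q]) simp
  then have "E z = qpoch_inf (- z) q"
    using iter by (simp add: LIMSEQ_const_iff)
  then show ?thesis
    using summable_sums[OF sm[OF z]] by (simp add: E_def e_def[abs_def])
qed

text \<open>Factor by factor this is \<open>(1 + x) * (1 - x) = 1 - x ^ 2\<close> with
  \<open>x = q ^ (n + 1)\<close>.\<close>

lemma qpoch_inf_minus_times:
  assumes "norm q < 1"
  shows "qpoch_inf (- q) q * qpoch_inf q q = qpoch_inf (q\<^sup>2) (q\<^sup>2)"
proof -
  have "norm (q\<^sup>2) < 1"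
    using assms by (simp add: norm_power power_less_one_iff)
  moreover have "(1 - (- q) * q ^ n) * (1 - q * q ^ n) = 1 - q\<^sup>2 * (q\<^sup>2) ^ n" for n
    by (simp add: power2_eq_square power_mult_distrib algebra_simps)
  ultimately show ?thesis
    using has_prod_mult[OF qpoch_inf_has_prod[OF assms, of "- q"] qpoch_inf_has_prod[OF assms, of q]]
      qpoch_inf_has_prod[of "q\<^sup>2" "q\<^sup>2"] has_prod_unique2
    by (metis (no_types, lifting) ext)
qed

text \<open>Over the reals a triangular number is a polynomial, so the exponent identities with
  truncated subtraction become ring identities in each case.\<close>

lemma real_Suc_choose_2: "real (Suc m choose 2) = real m * (real m + 1) / 2"
  by (induction m) (auto simp: numeral_2_eq_2 field_simps)

text \<open>With triangular weights in base \<open>q\<close> itself, the double sum above factors into two Euler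
  series.\<close>

lemma gauss_triangular:
  assumes q: "norm q < 1"
  shows "(\<lambda>m. norm (q ^ (Suc m choose 2))) summable_on UNIV"
    and "((\<lambda>m. q ^ (Suc m choose 2)) has_sum ((qpoch_inf (q\<^sup>2) (q\<^sup>2))\<^sup>2 / qpoch_inf q q)) UNIV"
proof -
  have le: "m \<le> Suc m choose 2" for m
    by (simp add: numeral_2_eq_2)
  have "summable (\<lambda>m. norm (q ^ (Suc m choose 2)))"
    by (rule summable_comparison_test'[where g = "\<lambda>m. norm q ^ m" and N = 0])
      (use q le in \<open>auto simp: norm_power intro!: power_decreasing summable_geometric\<close>)
  then show abs: "(\<lambda>m. norm (q ^ (Suc m choose 2))) summable_on UNIV"
    by (subst summable_on_UNIV_nonneg_real_iff) auto
  \<comment> \<open>Only the existence of \<open>S\<close> is known here; its value comes from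
    evaluating the double sum in two ways.\<close>
  obtain S where S: "((\<lambda>m. q ^ (Suc m choose 2)) has_sum S) UNIV"
    using has_sum_infsum[OF Infinite_Sum.abs_summable_summable[OF abs]] by blast
  define e where "e i = q ^ i * q ^ (i choose 2) / qpoch q q i" for i
  have e: "(\<lambda>x. norm (e x)) summable_on UNIV" "(e has_sum qpoch_inf (- q) q) UNIV"
    using summable_norm_euler[OF q q] norm_summable_imp_has_sum[OF summable_norm_euler[OF q q] euler_sums[OF q q]]
    by (auto simp: e_def[abs_def] summable_on_UNIV_nonneg_real_iff)
  have expo: "(Suc (if i \<le> j then j - i else i - j - 1) choose 2) + i * (j + 1)
      = (i + (i choose 2)) + (j + (j choose 2))" for i j
  proof -
    have "real ((Suc (if i \<le> j then j - i else i - j - 1) choose 2) + i * (j + 1))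
        = real ((Suc i choose 2) + (Suc j choose 2))"
      unfolding of_nat_add real_Suc_choose_2 by (auto simp: of_nat_diff field_simps)
    then show ?thesis
      unfolding of_nat_eq_iff by (simp add: numeral_2_eq_2)
  qed
  have "q ^ (Suc (if i \<le> j then j - i else i - j - 1) choose 2) * q ^ (i * (j + 1))
      / (qpoch q q i * qpoch q q j) = e i * e j" for i j
    unfolding power_add[symmetric] expo by (simp add: e_def power_add mult_ac)
  then have "((\<lambda>(i, j). e i * e j) has_sum (S / qpoch_inf q q)) UNIV"
    using weighted_double_sum[OF q abs S] by (simp only:)
  moreover have "((\<lambda>(i, j). e i * e j) has_sum (qpoch_inf (- q) q * qpoch_inf (- q) q)) UNIV"
    using has_sum_times(2)[OF e e] by simp
  ultimately have "S / qpoch_inf q q = qpoch_inf (- q) q * qpoch_inf (- q) q"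
    by (rule has_sum_unique)
  \<comment> \<open>\<open>S\<close> is \<open>qpoch_inf q q\<close> times the square of
    \<open>qpoch_inf (- q) q\<close>; completing the former to a square allows the product formula
    to be applied.\<close>
  then have "S = (qpoch_inf (q\<^sup>2) (q\<^sup>2))\<^sup>2 / qpoch_inf q q"
    using qpoch_inf_q_nonzero[OF q] unfolding qpoch_inf_minus_times[OF q, symmetric]
    by (simp add: power2_eq_square divide_simps mult_ac)
  with S show "((\<lambda>m. q ^ (Suc m choose 2)) has_sum ((qpoch_inf (q\<^sup>2) (q\<^sup>2))\<^sup>2 / qpoch_inf q q)) UNIV"
    by simp
qed

section \<open>Real powers of q and evaluation of the double sum\<close>

lemma qpow_add: "qpow L (s + t) = qpow L s * qpow L t"
  by (simp add: qpow_def distrib_right exp_add)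

lemma qpow_power: "qpow L s ^ n = qpow L (real n * s)"
  by (simp add: qpow_def exp_of_nat_mult[symmetric] mult_ac)

theorem theorem3p1:
  fixes q L :: complex and \<alpha> :: real
  assumes "0 < norm q" and "norm q < 1"
    and "exp L = q"
    and "\<alpha> > 0"
  shows "((\<lambda>(i::nat, j::nat).
            qpow L (\<alpha> / 2 * (real i)\<^sup>2 + (1 - \<alpha>) * real i * real j + \<alpha> / 2 * (real j)\<^sup>2
                    + (1 - \<alpha> / 2) * real i + \<alpha> / 2 * real j)
            / (qpoch q q i * qpoch q q j))
          has_sum
            ((qpoch_inf (qpow L (2 * \<alpha>)) (qpow L (2 * \<alpha>)))\<^sup>2
              / (qpoch_inf q q * qpoch_inf (qpow L \<alpha>) (qpow L \<alpha>))))
          UNIV"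
proof -
  have q: "norm q < 1" by fact
  define Q where "Q = qpow L \<alpha>"
  \<comment> \<open>\<open>norm Q\<close> is \<open>exp (\<alpha> * Re L)\<close>, so
    \<open>Re L < 0\<close> and \<open>\<alpha> > 0\<close> put the base \<open>Q\<close> inside the
    unit disc whichever logarithm \<open>L\<close> is.\<close>
  have "exp (Re L) = norm q"
    using assms(3) by (metis norm_exp_eq_Re)
  then have "Re L < 0"
    using q by (metis exp_less_one_iff)
  then have Q: "norm Q < 1"
    using \<open>\<alpha> > 0\<close> by (simp add: Q_def qpow_def norm_exp_eq_Re mult_pos_neg)
  have q1: "q = qpow L 1"
    using assms(3) by (simp add: qpow_def)
  have Q2: "Q\<^sup>2 = qpow L (2 * \<alpha>)"
    by (simp add: Q_def qpow_power)
  \<comment> \<open>Both branches of the \<open>if\<close> have the triangular number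
    \<open>n * (n - 1) / 2\<close> with \<open>n = i - j\<close>.\<close>
  have expo: "Q ^ (Suc (if i \<le> j then j - i else i - j - 1) choose 2) * q ^ (i * (j + 1))
      = qpow L (\<alpha> / 2 * (real i)\<^sup>2 + (1 - \<alpha>) * real i * real j + \<alpha> / 2 * (real j)\<^sup>2
                    + (1 - \<alpha> / 2) * real i + \<alpha> / 2 * real j)" for i j
  proof -
    have "real (Suc (if i \<le> j then j - i else i - j - 1) choose 2) * \<alpha> + real (i * (j + 1)) * 1
      = \<alpha> / 2 * (real i)\<^sup>2 + (1 - \<alpha>) * real i * real j + \<alpha> / 2 * (real j)\<^sup>2
                    + (1 - \<alpha> / 2) * real i + \<alpha> / 2 * real j"
      unfolding real_Suc_choose_2 by (auto simp: of_nat_diff power2_eq_square field_simps)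
    then show ?thesis
      unfolding q1 Q_def qpow_power qpow_add[symmetric] by simp
  qed
  \<comment> \<open>The weights are powers of \<open>Q\<close>: their sum is Gauss's product in base
    \<open>Q\<close>, while the diagonals contribute \<open>1 / qpoch_inf q q\<close> in base
    \<open>q\<close>.\<close>
  show ?thesis
    using weighted_double_sum[OF q gauss_triangular[OF Q]]
    unfolding expo Q2 unfolding Q_def by (simp add: mult_ac)
qed

end
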